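(* Let the mappings $\mathcal A$, $\mathcal B$ and the preconditioning matrix $\Phi$ be defined as $$\mathcal A:\begin{bmatrix}\boldsymbol x\\ \boldsymbol\sigma\end{bmatrix}\mapsto\begin{bmatrix}F_\sigma(\boldsymbol x,\boldsymbol\sigma)\\0\end{bmatrix}+\tfrac12\begin{bmatrix}0&-P\\P&0\end{bmatrix}\begin{bmatrix}\boldsymbol x\\ \boldsymbol\sigma\end{bmatrix},\qquad \mathcal B:\begin{bmatrix}\boldsymbol x\\ \boldsymbol\sigma\end{bmatrix}\mapsto\begin{bmatrix}\mathrm N_{\boldsymbol\Omega}(\boldsymbol x)\\L_n\boldsymbol\sigma\end{bmatrix}+\tfrac12\begin{bmatrix}0&P\\-P&0\end{bmatrix}\begin{bmatrix}\boldsymbol x\\ \boldsymbol\sigma\end{bmatrix},$$ $$\Phi:=\begin{bmatrix}\alpha^{-1}I&-\tfrac12P\\-\tfrac12P&P\end{bmatrix},$$ where $L_n:=L\otimes I_n$ and $P:=I+E\otimes I_n$. Then the sequence $(\mathrm{col}(\boldsymbol x^k,\boldsymbol\sigma^k))_{k=0}^\infty$ generated by the preconditioned forward-backward iteration $$\boldsymbol\omega^{k+1}=(\mathrm{Id}+\Phi^{-1}\mathcal B)^{-1}\circ(\mathrm{Id}-\Phi^{-1}\mathcal A)(\boldsymbol\omega^k),\qquad \boldsymbol\omega^k=\mathrm{col}(\boldsymbol x^k,\boldsymbol\sigma^k),$$ with these $\mathcal A$, $\mathcal B$, $\Phi$, corresponds to the sequence $(\mathrm{col}(\boldsymbol x^k,(W\otimes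 I_n)\boldsymbol v^k))_{k=0}^\infty$ generated by the Koshal–Nedić–Shanbhag algorithm $$\boldsymbol x^{k+1}=\mathrm{proj}_{\boldsymbol{\mathcal X}}\big[\boldsymbol x^k-\alpha F_\sigma(\boldsymbol x^k,(W\otimes I_n)\boldsymbol v^k)\big],\qquad \boldsymbol v^{k+1}=\mathrm{proj}_{\mathbb R^{nN}}\big[(W\otimes I_n)\boldsymbol v^k+\boldsymbol x^{k+1}-\boldsymbol x^k\big].$$
   Context: Setting. Let $\mathcal N=\{1,\dots,N\}$. Consider an average aggregative game without coupling constraints: agent $i\in\mathcal N$ has decision set $\Omega_i\subseteq\mathbb R^n$ and cost $J_i(x_i,\boldsymbol x_{-i})=f_i\big(x_i,\frac1N\sum_{j=1}^Nx_j\big)$, where $\boldsymbol x_{-i}$ stacks the $x_j$ with $j\ne i$. Let $\boldsymbol x=\mathrm{col}(x_1,\dots,x_N)\in\mathbb R^{nN}$ and $\boldsymbol\Omega:=\Omega_1\times\cdots\times\Omega_N$. Since there are no coupling constraints, the collective feasible set is $\boldsymbol{\mathcal X}=\boldsymbol\Omega$. Standing assumptions. Each $\Omega_i$ is nonempty, compact and convex; for each $i$ and each $\boldsymbol y\in\prod_{j\ne i}\Omega_j$, the function $J_i(\cdot,\boldsymbol y)$ is convex and continuously differentiable; the pseudo-gradient $F(\boldsymbol x)=\mathrm{col}(\{\partial_{x_i}J_i(x_i,\boldsymbol x_{-i})\}_{i\in\mathcal N})$, defined on $\boldsymbol{\mathcal X}$, is strongly monotone and Lipschitz continuous. Extended pseudo-gradient,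 on the augmented space of actions and estimates: $F_\sigma:\boldsymbol{\mathcal X}\times\mathbb R^{nN}\rightrightarrows\mathbb R^{nN}$, $F_\sigma(\boldsymbol x,\boldsymbol z):=\mathrm{col}(\{\partial_{x_i}f_i(x_i,z_i)\}_{i\in\mathcal N})$, with $\boldsymbol z=\mathrm{col}(z_1,\dots,z_N)$, $z_i\in\mathbb R^n$, where $\partial_{x_i}$ denotes the subdifferential with respect to the first argument $x_i$. It satisfies $F_\sigma(\boldsymbol x,\boldsymbol 1_N\otimes\frac1N\sum_jx_j)=F(\boldsymbol x)$. Graph. The agents communicate over an undirected graph; $\mathcal N_i$ is the set of neighbors of agent $i$, with the convention $i\notin\mathcal N_i$; $d_i:=|\mathcal N_i|$; $D:=\mathrm{diag}(d_1,\dots,d_N)$ is the degree matrix; $E$ is the adjacency matrix ($[E]_{ij}=1$ if $j\in\mathcal N_i$, and $0$ otherwise); $L:=D-E$ is the Laplacian; $W:=(I+D)^{-1}(I+E)$, so that $[(W\otimes I_n)\boldsymbol v]_i=\frac1{|\mathcal N_i|+1}\sum_{j\in\mathcal N_i\cup\{i\}}v_j$ for $\boldsymbol v=\mathrm{col}(v_1,\dots,v_N)$, $v_i\in\mathbb R^n$. Notation. $\alpha>0$ is the step size of the algorithm; $\otimes$ is the Kronecker product; $\mathrm{Id}$ is the identity operator; $\mathrm{proj}_S$ is the Euclidean projection onto $S$; $\mathrm N_S(x)=\{v:\sup_{z\in S}v^\top(z-x)\le0\}$ if $x\in S$, and $\varnothing$ otherwise. The preconditioned forward-backward iteration for operators $\mathcal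 A,\mathcal B$ is the displayed fixed-point (Banach–Picard) iteration, introduced for preconditioning matrices $\Phi\succ0$. *)

theory Defs
  imports "HOL-Analysis.Analysis"
begin

text \<open>
  Agents are the elements of a finite type \<open>'N\<close> and \<open>\<real>\<^sup>n\<close> is \<^typ>\<open>real^'n\<close>; a stacked vector
  \<open>col(x\<^sub>1,\<dots>,x\<^sub>N)\<close> is an element of \<^typ>\<open>real^'n^'N\<close>, whose inner product is that of \<open>\<real>\<^sup>n\<^sup>N\<close>.
  Set-valued operators are functions into sets.
\<close>

definition subdifferential :: "('a::real_inner \<Rightarrow> real) \<Rightarrow> 'a \<Rightarrow> 'a set" where
  "subdifferential g x = {v. \<forall>y. g y \<ge> g x + v \<bullet> (y - x)}"

definition normal_cone :: "'a::real_inner set \<Rightarrow> 'a \<Rightarrow> 'a set" where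
  "normal_cone S x = (if x \<in> S then {v. \<forall>z\<in>S. v \<bullet> (z - x) \<le> 0} else {})"

definition gradient :: "('a::real_inner \<Rightarrow> real) \<Rightarrow> 'a \<Rightarrow> 'a" where
  "gradient g x = (THE D. GDERIV g x :> D)"

definition cont_differentiable :: "('a::real_inner \<Rightarrow> real) \<Rightarrow> bool" where
  "cont_differentiable g \<longleftrightarrow>
     (\<forall>x. \<exists>D. GDERIV g x :> D) \<and> continuous_on UNIV (gradient g)"

definition strongly_monotone_on :: "'a::real_inner set \<Rightarrow> ('a \<Rightarrow> 'a) \<Rightarrow> bool" where
  "strongly_monotone_on S G \<longleftrightarrow>
     (\<exists>\<mu>>0. \<forall>x\<in>S. \<forall>y\<in>S. (G x - G y) \<bullet> (x - y) \<ge> \<mu> * (norm (x - y))\<^sup>2)"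

definition op_inverse :: "('a \<Rightarrow> 'b set) \<Rightarrow> 'b \<Rightarrow> 'a set" where
  "op_inverse T y = {x. y \<in> T x}"

definition op_comp :: "('b \<Rightarrow> 'c set) \<Rightarrow> ('a \<Rightarrow> 'b set) \<Rightarrow> 'a \<Rightarrow> 'c set" where
  "op_comp S T x = (\<Union>y\<in>T x. S y)"

definition generated_by :: "('a \<Rightarrow> 'a set) \<Rightarrow> (nat \<Rightarrow> 'a) \<Rightarrow> bool" where
  "generated_by T \<omega> \<longleftrightarrow> (\<forall>k. \<omega> (Suc k) \<in> T (\<omega> k))"

text \<open>\<open>(Id + \<Phi>\<inverse>B)\<inverse> \<circ> (Id - \<Phi>\<inverse>A)\<close>; meaningful only for bijective \<open>\<Phi>\<close>.\<close>

definition precond_fb ::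
  "('a::real_vector \<Rightarrow> 'a) \<Rightarrow> ('a \<Rightarrow> 'a set) \<Rightarrow> ('a \<Rightarrow> 'a set) \<Rightarrow> 'a \<Rightarrow> 'a set" where
  "precond_fb \<Phi> A B =
     op_comp (op_inverse (\<lambda>\<omega>. (\<lambda>b. \<omega> + inv \<Phi> b) ` B \<omega>))
             (\<lambda>\<omega>. (\<lambda>a. \<omega> - inv \<Phi> a) ` A \<omega>)"

text \<open>
  \<open>(\<Phi> + B)\<inverse> \<circ> (\<Phi> - A)\<close>: the same operator when \<open>\<Phi>\<close> is linear and bijective, but
  meaningful for singular \<open>\<Phi>\<close> too.
\<close>

definition precond_fb_inclusion ::
  "('a::real_vector \<Rightarrow> 'a) \<Rightarrow> ('a \<Rightarrow> 'a set) \<Rightarrow> ('a \<Rightarrow> 'a set) \<Rightarrow> 'a \<Rightarrow> 'a set" where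
  "precond_fb_inclusion \<Phi> A B =
     op_comp (op_inverse (\<lambda>\<omega>. (\<lambda>b. \<Phi> \<omega> + b) ` B \<omega>))
             (\<lambda>\<omega>. (\<lambda>a. \<Phi> \<omega> - a) ` A \<omega>)"

definition degree_matrix :: "('N::finite \<Rightarrow> 'N set) \<Rightarrow> real^'N^'N" where
  "degree_matrix nbr = (\<chi> i j. if i = j then real (card (nbr i)) else 0)"

definition adjacency_matrix :: "('N::finite \<Rightarrow> 'N set) \<Rightarrow> real^'N^'N" where
  "adjacency_matrix nbr = (\<chi> i j. if j \<in> nbr i then 1 else 0)"

definition laplacian_matrix :: "('N::finite \<Rightarrow> 'N set) \<Rightarrow> real^'N^'N" where
  "laplacian_matrix nbr = degree_matrix nbr - adjacency_matrix nbr"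

definition weight_matrix :: "('N::finite \<Rightarrow> 'N set) \<Rightarrow> real^'N^'N" where
  "weight_matrix nbr =
     matrix_inv (mat 1 + degree_matrix nbr) ** (mat 1 + adjacency_matrix nbr)"

text \<open>The action of \<open>M \<otimes> I\<^sub>n\<close> on stacked vectors.\<close>

definition kron_id :: "real^'N^'N \<Rightarrow> real^'n^'N \<Rightarrow> real^'n^'N" where
  "kron_id M v = (\<chi> i. \<Sum>j\<in>UNIV. M $ i $ j *\<^sub>R v $ j)"

definition Pmat :: "('N::finite \<Rightarrow> 'N set) \<Rightarrow> real^'n^'N \<Rightarrow> real^'n^'N" where
  "Pmat nbr v = v + kron_id (adjacency_matrix nbr) v"

definition collective_set :: "('N::finite \<Rightarrow> (real^'n) set) \<Rightarrow> (real^'n^'N) set" where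
  "collective_set \<Omega> = {x. \<forall>i. x $ i \<in> \<Omega> i}"

text \<open>\<open>J\<^sub>i(u, x\<^sub>-\<^sub>i)\<close>; the component \<open>x\<^sub>i\<close> of the last argument is ignored.\<close>

definition agent_cost ::
  "('N::finite \<Rightarrow> real^'n \<Rightarrow> real^'n \<Rightarrow> real) \<Rightarrow> 'N \<Rightarrow> real^'n \<Rightarrow> real^'n^'N \<Rightarrow> real" where
  "agent_cost f i u x =
     f i u ((1 / real CARD('N)) *\<^sub>R (u + (\<Sum>j\<in>UNIV - {i}. x $ j)))"

definition pseudo_gradient ::
  "('N::finite \<Rightarrow> real^'n \<Rightarrow> real^'n \<Rightarrow> real) \<Rightarrow> real^'n^'N \<Rightarrow> real^'n^'N" where
  "pseudo_gradient f x = (\<chi> i. gradient (\<lambda>u. agent_cost f i u x) (x $ i))"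

text \<open>\<open>F\<^sub>\<sigma>\<close> has domain \<open>X \<times> \<real>\<^sup>n\<^sup>N\<close>, hence no values outside it.\<close>

definition ext_pseudo_gradient ::
  "('N::finite \<Rightarrow> (real^'n) set) \<Rightarrow> ('N \<Rightarrow> real^'n \<Rightarrow> real^'n \<Rightarrow> real) \<Rightarrow>
   real^'n^'N \<Rightarrow> real^'n^'N \<Rightarrow> (real^'n^'N) set" where
  "ext_pseudo_gradient \<Omega> f x z =
     (if x \<in> collective_set \<Omega>
      then {g. \<forall>i. g $ i \<in> subdifferential (\<lambda>u. f i u (z $ i)) (x $ i)}
      else {})"

definition opA ::
  "('N::finite \<Rightarrow> (real^'n) set) \<Rightarrow> ('N \<Rightarrow> real^'n \<Rightarrow> real^'n \<Rightarrow> real) \<Rightarrow> ('N \<Rightarrow> 'N set) \<Rightarrow>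
   (real^'n^'N) \<times> (real^'n^'N) \<Rightarrow> ((real^'n^'N) \<times> (real^'n^'N)) set" where
  "opA \<Omega> f nbr = (\<lambda>(x, \<sigma>).
     (\<lambda>g. (g, 0) + (1/2) *\<^sub>R (- Pmat nbr \<sigma>, Pmat nbr x)) ` ext_pseudo_gradient \<Omega> f x \<sigma>)"

definition opB ::
  "('N::finite \<Rightarrow> (real^'n) set) \<Rightarrow> ('N \<Rightarrow> 'N set) \<Rightarrow>
   (real^'n^'N) \<times> (real^'n^'N) \<Rightarrow> ((real^'n^'N) \<times> (real^'n^'N)) set" where
  "opB \<Omega> nbr = (\<lambda>(x, \<sigma>).
     (\<lambda>v. (v, kron_id (laplacian_matrix nbr) \<sigma>) + (1/2) *\<^sub>R (Pmat nbr \<sigma>, - Pmat nbr x))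
       ` normal_cone (collective_set \<Omega>) x)"

definition precond ::
  "real \<Rightarrow> ('N::finite \<Rightarrow> 'N set) \<Rightarrow>
   (real^'n^'N) \<times> (real^'n^'N) \<Rightarrow> (real^'n^'N) \<times> (real^'n^'N)" where
  "precond \<alpha> nbr = (\<lambda>(x, \<sigma>).
     ((1/\<alpha>) *\<^sub>R x - (1/2) *\<^sub>R Pmat nbr \<sigma>, - ((1/2) *\<^sub>R Pmat nbr x) + Pmat nbr \<sigma>))"

definition kns_step ::
  "real \<Rightarrow> ('N::finite \<Rightarrow> (real^'n) set) \<Rightarrow> ('N \<Rightarrow> real^'n \<Rightarrow> real^'n \<Rightarrow> real) \<Rightarrow>
   ('N \<Rightarrow> 'N set) \<Rightarrow> (real^'n^'N) \<times> (real^'n^'N) \<Rightarrow> ((real^'n^'N) \<times> (real^'n^'N)) set" where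
  "kns_step \<alpha> \<Omega> f nbr = (\<lambda>(x, v).
     {(x', v'). x' \<in> (\<lambda>g. closest_point (collective_set \<Omega>) (x - \<alpha> *\<^sub>R g))
                       ` ext_pseudo_gradient \<Omega> f x (kron_id (weight_matrix nbr) v) \<and>
                v' = closest_point UNIV (kron_id (weight_matrix nbr) v + x' - x)})"

end

theory Submission
  imports Defs
begin

text \<open>
  Multiplying the iteration by \<open>\<Phi>\<close>, the skew parts of \<open>A\<close> and \<open>B\<close> cancel the off-diagonal blocks
  of \<open>\<Phi>\<close>. The first row becomes \<open>\<alpha>\<inverse>(x - x') - g \<in> N(x')\<close>, which characterises the projection.
  The second row becomes \<open>(P + L\<^sub>n) \<sigma>' = P (\<sigma> + x' - x)\<close>, and \<open>P + L\<^sub>n = (I + D) \<otimes> I\<^sub>n\<close>, so that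
  \<open>\<sigma>' = W (\<sigma> + x' - x)\<close>, that is, \<open>\<sigma>' = W v'\<close> for the \<open>v'\<close> of the algorithm.
\<close>

lemma kron_id_mult: "kron_id (A ** B) v = kron_id A (kron_id B v)"
proof -
  have "(\<Sum>j\<in>UNIV. \<Sum>k\<in>UNIV. (A $ i $ k * B $ k $ j) *\<^sub>R v $ j)
      = (\<Sum>k\<in>UNIV. \<Sum>j\<in>UNIV. (A $ i $ k * B $ k $ j) *\<^sub>R v $ j)" for i
    by (rule sum.swap)
  then show ?thesis
    by (simp add: kron_id_def vec_eq_iff matrix_matrix_mult_def scaleR_left.sum scaleR_right.sum)
qed

lemma kron_id_mat_1: "kron_id (mat 1) v = v"
  by (simp add: kron_id_def vec_eq_iff mat_def if_distrib if_distribR cong: if_cong)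

lemma kron_id_add_left: "kron_id (A + B) v = kron_id A v + kron_id B v"
  by (simp add: kron_id_def vec_eq_iff scaleR_left_distrib sum.distrib)

lemma linear_kron_id: "linear (kron_id A)"
  by (rule linearI)
    (simp_all add: kron_id_def vec_eq_iff scaleR_right_distrib sum.distrib scaleR_sum_right
      mult.commute)

lemma Pmat_eq_kron_id: "Pmat nbr = kron_id (mat 1 + adjacency_matrix nbr)"
  by (simp add: fun_eq_iff Pmat_def kron_id_add_left kron_id_mat_1)

lemma linear_Pmat: "linear (Pmat nbr)"
  by (simp add: Pmat_eq_kron_id linear_kron_id)

lemma invertible_mat_1_plus_degree: "invertible (mat 1 + degree_matrix nbr)"
proof -
  have "det (mat 1 + degree_matrix nbr) = (\<Prod>i\<in>UNIV. 1 + real (card (nbr i)))"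
    by (subst det_diagonal) (simp_all add: mat_def degree_matrix_def)
  also have "\<dots> > 0"
    by (intro prod_pos) simp
  finally show ?thesis
    by (simp add: invertible_det_nz)
qed

text \<open>In \<open>P + L_n\<close> the adjacency parts cancel, leaving \<open>I + D\<close>,
  whose inverse is the first factor of \<open>W\<close>. The equation form serves both the second
  row of the iteration and the search for an initial \<open>v\<close>.\<close>

lemma kron_id_weight_matrix_iff:
  "s = kron_id (weight_matrix nbr) v \<longleftrightarrow>
   Pmat nbr s + kron_id (laplacian_matrix nbr) s = Pmat nbr v"
proof -
  let ?D = "mat 1 + degree_matrix nbr"
  have inv: "matrix_inv ?D ** ?D = mat 1" "?D ** matrix_inv ?D = mat 1"
    \<comment> \<open>\<open>matrix_inv\<close> is a choice operator, so both inverse laws come from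
      the existence of a two-sided inverse.\<close>
    using someI_ex[OF invertible_mat_1_plus_degree[unfolded invertible_def]]
    by (auto simp: matrix_inv_def)
  have PL: "Pmat nbr s + kron_id (laplacian_matrix nbr) s = kron_id ?D s"
    by (simp add: Pmat_eq_kron_id laplacian_matrix_def flip: kron_id_add_left)
  have "s = kron_id (matrix_inv ?D) (Pmat nbr v) \<longleftrightarrow> kron_id ?D s = Pmat nbr v"
    using inv by (metis kron_id_mult kron_id_mat_1)
  then show ?thesis
    unfolding PL weight_matrix_def kron_id_mult by (simp only: Pmat_eq_kron_id)
qed

lemma collective_set_convex:
  assumes "\<And>i. convex (\<Omega> i)"
  shows "convex (collective_set \<Omega>)"
  using assms by (simp add: convex_def collective_set_def)

lemma collective_set_closed:
  assumes "\<And>i. closed (\<Omega> i)"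
  shows "closed (collective_set \<Omega>)"
  unfolding collective_set_def Collect_all_eq
  by (intro closed_INT ballI closed_vimage_vec_nth[unfolded vimage_def] assms)

lemma collective_set_nonempty:
  assumes "\<And>i. \<Omega> i \<noteq> {}"
  shows "collective_set \<Omega> \<noteq> {}"
proof -
  have "(\<chi> i. SOME a. a \<in> \<Omega> i) \<in> collective_set \<Omega>"
    using assms by (simp add: collective_set_def some_in_eq)
  then show ?thesis
    by blast
qed

text \<open>The variational inequality for projections. It turns the resolvent of the normal cone
  into the projection step.\<close>

lemma closest_point_eq_iff_normal_cone:
  fixes S :: "'a::euclidean_space set"
  assumes "convex S" "closed S" "S \<noteq> {}"
  shows "p = closest_point S y \<longleftrightarrow> y - p \<in> normal_cone S p"
proof
  assume "p = closest_point S y"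
  then show "y - p \<in> normal_cone S p"
    using closest_point_dot[OF assms(1,2)] closest_point_in_set[OF assms(2,3)]
    by (simp add: normal_cone_def)
next
  assume "y - p \<in> normal_cone S p"
  then have p: "p \<in> S" and le: "\<And>z. z \<in> S \<Longrightarrow> (y - p) \<bullet> (z - p) \<le> 0"
    by (auto simp: normal_cone_def split: if_splits)
  have "dist y p \<le> dist y z" if "z \<in> S" for z
  proof -
    \<comment> \<open>The law of cosines at \<open>p\<close>; the normal cone makes the last term
      nonnegative.\<close>
    have "(dist y z)\<^sup>2 = (dist y p)\<^sup>2 + (dist p z)\<^sup>2 - 2 * ((y - p) \<bullet> (z - p))"
      by (simp add: dist_norm power2_norm_eq_inner algebra_simps inner_commute)
    then have "(dist y p)\<^sup>2 \<le> (dist y z)\<^sup>2"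
      using le[OF that] zero_le_power2[of "dist p z"] by linarith
    then show ?thesis
      by (rule power2_le_imp_le) simp
  qed
  then show "p = closest_point S y"
    by (intro closest_point_unique[OF assms(1,2) p]) simp
qed

lemma normal_cone_scaleR_iff:
  assumes "c > 0"
  shows "c *\<^sub>R v \<in> normal_cone S x \<longleftrightarrow> v \<in> normal_cone S x"
  using assms by (simp add: normal_cone_def mult_le_0_iff)

text \<open>Applying the injective \<open>\<Phi>\<close> to both sides of the defining equation of a
  step removes \<open>inv \<Phi>\<close>.\<close>

lemma precond_fb_eq_precond_fb_inclusion:
  assumes "linear \<Phi>" "bij \<Phi>"
  shows "precond_fb \<Phi> A B = precond_fb_inclusion \<Phi> A B"
proof -
  have *: "w - inv \<Phi> a = w' + inv \<Phi> b \<longleftrightarrow> \<Phi> w - a = \<Phi> w' + b" for w w' a b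
  proof -
    have "w - inv \<Phi> a = w' + inv \<Phi> b \<longleftrightarrow> \<Phi> (w - inv \<Phi> a) = \<Phi> (w' + inv \<Phi> b)"
      using assms(2) by (simp add: bij_is_inj inj_eq)
    also have "\<dots> \<longleftrightarrow> \<Phi> w - a = \<Phi> w' + b"
      using assms by (simp add: linear_diff linear_add bij_is_surj surj_f_inv_f)
    finally show ?thesis .
  qed
  show ?thesis
    by (simp add: fun_eq_iff set_eq_iff precond_fb_def precond_fb_inclusion_def op_comp_def
        op_inverse_def image_iff *)
qed

lemma linear_precond: "linear (precond \<alpha> nbr)"
  by (rule linearI)
    (auto simp: precond_def linear_add[OF linear_Pmat] linear_cmul[OF linear_Pmat] algebra_simps)

text \<open>The second block row of \<open>\<Phi>\<close> is \<open>P\<close> applied to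
  \<open>s - x/2\<close>, so its range lies in that of \<open>P\<close>.\<close>

lemma surj_Pmat:
  assumes "surj (precond \<alpha> nbr :: (real^'n^'N) \<times> (real^'n^'N) \<Rightarrow> _)"
  shows "surj (Pmat nbr :: real^'n^'N \<Rightarrow> real^'n^'N)"
proof -
  have "y \<in> range (Pmat nbr)" for y :: "real^'n^'N"
  proof -
    obtain x s :: "real^'n^'N" where "(0, y) = precond \<alpha> nbr (x, s)"
      using assms by (metis surjD surj_pair)
    then have "y = Pmat nbr (s - (1/2) *\<^sub>R x)"
      by (simp add: precond_def linear_diff[OF linear_Pmat] linear_cmul[OF linear_Pmat])
    then show ?thesis
      by blast
  qed
  then show ?thesis
    by blast
qed

text \<open>One step, with no inverse of \<open>\<Phi>\<close> involved: the first row gives the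
  projection, the second the averaging by \<open>W\<close>.\<close>

lemma precond_fb_inclusion_iff:
  fixes \<Omega> :: "'N::finite \<Rightarrow> (real^'n) set"
  assumes sets: "\<And>i. \<Omega> i \<noteq> {} \<and> compact (\<Omega> i) \<and> convex (\<Omega> i)" and "\<alpha> > 0"
  shows "(x', s') \<in> precond_fb_inclusion (precond \<alpha> nbr) (opA \<Omega> f nbr) (opB \<Omega> nbr) (x, s) \<longleftrightarrow>
    x' \<in> (\<lambda>g. closest_point (collective_set \<Omega>) (x - \<alpha> *\<^sub>R g)) ` ext_pseudo_gradient \<Omega> f x s \<and>
    s' = kron_id (weight_matrix nbr) (s + x' - x)"
proof -
  let ?X = "collective_set \<Omega>"
  let ?L = "kron_id (laplacian_matrix nbr)"
  have row1: "x' = closest_point ?X (x - \<alpha> *\<^sub>R g) \<longleftrightarrow>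
      (1/\<alpha>) *\<^sub>R x - (1/\<alpha>) *\<^sub>R x' - g \<in> normal_cone ?X x'" for g
  proof -
    have "x' = closest_point ?X (x - \<alpha> *\<^sub>R g) \<longleftrightarrow> x - \<alpha> *\<^sub>R g - x' \<in> normal_cone ?X x'"
      using sets by (intro closest_point_eq_iff_normal_cone collective_set_convex
        collective_set_closed collective_set_nonempty) (auto simp: compact_imp_closed)
    \<comment> \<open>A normal cone is invariant under positive scaling, so the step size can be
      divided out.\<close>
    also have "\<dots> \<longleftrightarrow> (1/\<alpha>) *\<^sub>R (x - \<alpha> *\<^sub>R g - x') \<in> normal_cone ?X x'"
      using \<open>\<alpha> > 0\<close> by (simp only: normal_cone_scaleR_iff zero_less_divide_1_iff)
    also have "(1/\<alpha>) *\<^sub>R (x - \<alpha> *\<^sub>R g - x') = (1/\<alpha>) *\<^sub>R x - (1/\<alpha>) *\<^sub>R x' - g"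
      using \<open>\<alpha> > 0\<close> by (simp add: algebra_simps)
    finally show ?thesis .
  qed
  have half: "(1/2) *\<^sub>R y + (1/2) *\<^sub>R y = y" for y :: "real^'n^'N"
    by (simp flip: scaleR_left_distrib)
  have row2: "s' = kron_id (weight_matrix nbr) (s + x' - x) \<longleftrightarrow>
      - ((1/2) *\<^sub>R Pmat nbr x) + Pmat nbr s - (1/2) *\<^sub>R Pmat nbr x
      = - ((1/2) *\<^sub>R Pmat nbr x') + Pmat nbr s' + (?L s' - (1/2) *\<^sub>R Pmat nbr x')"
  proof -
    have "u + l = p + b - a \<longleftrightarrow>
        - ((1/2) *\<^sub>R a) + p - (1/2) *\<^sub>R a = - ((1/2) *\<^sub>R b) + u + (l - (1/2) *\<^sub>R b)"
      for a b p u l :: "real^'n^'N"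
    proof -
      \<comment> \<open>With \<open>c\<close> and \<open>d\<close> standing for the halves of
        \<open>a\<close> and \<open>b\<close>, the claim is an identity of abelian groups.\<close>
      have "u + l = p + (d + d) - (c + c) \<longleftrightarrow> - c + p - c = - d + u + (l - d)"
        for c d :: "real^'n^'N"
        by (auto simp: algebra_simps)
      from this[of "(1/2) *\<^sub>R b" "(1/2) *\<^sub>R a"] show ?thesis
        by (simp only: half)
    qed
    then show ?thesis
      by (simp only: kron_id_weight_matrix_iff linear_add[OF linear_Pmat]
          linear_diff[OF linear_Pmat])
  qed
  \<comment> \<open>In the first row the skew halves cancel those of \<open>\<Phi>\<close>; in the
    second they have the same sign and add up to a full \<open>P x\<close> and
    \<open>P x'\<close>.\<close>
  have "(x', s') \<in> precond_fb_inclusion (precond \<alpha> nbr) (opA \<Omega> f nbr) (opB \<Omega> nbr) (x, s) \<longleftrightarrow>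
    (\<exists>g\<in>ext_pseudo_gradient \<Omega> f x s. \<exists>n\<in>normal_cone ?X x'.
       (1/\<alpha>) *\<^sub>R x - (1/\<alpha>) *\<^sub>R x' - g = n \<and>
       - ((1/2) *\<^sub>R Pmat nbr x) + Pmat nbr s - (1/2) *\<^sub>R Pmat nbr x
       = - ((1/2) *\<^sub>R Pmat nbr x') + Pmat nbr s' + (?L s' - (1/2) *\<^sub>R Pmat nbr x'))"
    by (auto simp: precond_fb_inclusion_def op_comp_def op_inverse_def opA_def opB_def precond_def
        image_iff algebra_simps)
  then show ?thesis
    unfolding row2[symmetric] image_iff row1 by blast
qed

lemma kns_step_iff:
  "(x', v') \<in> kns_step \<alpha> \<Omega> f nbr (x, v) \<longleftrightarrow>
    x' \<in> (\<lambda>g. closest_point (collective_set \<Omega>) (x - \<alpha> *\<^sub>R g))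
           ` ext_pseudo_gradient \<Omega> f x (kron_id (weight_matrix nbr) v) \<and>
    v' = kron_id (weight_matrix nbr) v + x' - x"
  by (simp add: kns_step_def closest_point_self)

text \<open>\<open>W\<close> may be singular, so \<open>s 0\<close> need not determine
  \<open>v 0\<close>; hence \<open>v0\<close> is prescribed. Later \<open>v k\<close> are fixed by
  the algorithm.\<close>

lemma precond_fb_inclusion_generated_iff:
  fixes \<Omega> :: "'N::finite \<Rightarrow> (real^'n) set"
  assumes sets: "\<And>i. \<Omega> i \<noteq> {} \<and> compact (\<Omega> i) \<and> convex (\<Omega> i)" and "\<alpha> > 0"
    and init: "s 0 = kron_id (weight_matrix nbr) v0"
  shows "generated_by (precond_fb_inclusion (precond \<alpha> nbr) (opA \<Omega> f nbr) (opB \<Omega> nbr))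
      (\<lambda>k. (x k, s k)) \<longleftrightarrow>
    (\<exists>v. v 0 = v0 \<and> generated_by (kns_step \<alpha> \<Omega> f nbr) (\<lambda>k. (x k, v k)) \<and>
      (\<forall>k. s k = kron_id (weight_matrix nbr) (v k)))"
    (is "?fb \<longleftrightarrow> ?kns")
proof
  assume fb: ?fb
  \<comment> \<open>The update of the algorithm, with \<open>s k\<close> in place of
    \<open>W\<close> applied to \<open>v k\<close>.\<close>
  define v where "v = case_nat v0 (\<lambda>k. s k + x (Suc k) - x k)"
  have step: "x (Suc k) \<in> (\<lambda>g. closest_point (collective_set \<Omega>) (x k - \<alpha> *\<^sub>R g))
                ` ext_pseudo_gradient \<Omega> f (x k) (s k)"
      "s (Suc k) = kron_id (weight_matrix nbr) (s k + x (Suc k) - x k)" for k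
    using fb by (simp_all add: generated_by_def precond_fb_inclusion_iff[OF sets \<open>\<alpha> > 0\<close>])
  have s: "s k = kron_id (weight_matrix nbr) (v k)" for k
    by (cases k) (simp_all add: v_def init step(2))
  have "generated_by (kns_step \<alpha> \<Omega> f nbr) (\<lambda>k. (x k, v k))"
    \<comment> \<open>\<open>v\<close> stays folded until \<open>W\<close> applied to
      \<open>v k\<close> has been rewritten to \<open>s k\<close>.\<close>
    using step(1) by (simp add: generated_by_def kns_step_iff flip: s) (simp add: v_def)
  moreover have "v 0 = v0"
    by (simp add: v_def)
  ultimately show ?kns
    using s by blast
next
  assume ?kns
  then show ?fb
    by (auto simp: generated_by_def kns_step_iff precond_fb_inclusion_iff[OF sets \<open>\<alpha> > 0\<close>])
qed

text \<open>\<open>\<Phi>\<close> can be singular: for two adjacent agents \<open>P\<close> has a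
  kernel, and \<open>\<Phi>\<close> vanishes on \<open>(0, \<sigma>)\<close> for
  \<open>\<sigma>\<close> in it. So the form with \<open>inv \<Phi>\<close> is treated for bijective
  \<open>\<Phi>\<close>, and the inclusion form for every \<open>\<Phi>\<close>, started in the
  range of \<open>W\<close>.\<close>

theorem proposition2:
  fixes \<Omega> :: "'N::finite \<Rightarrow> (real^'n) set"
    and f :: "'N \<Rightarrow> real^'n \<Rightarrow> real^'n \<Rightarrow> real"
    and nbr :: "'N \<Rightarrow> 'N set"
    and \<alpha> :: real
  assumes undirected: "\<And>i j. j \<in> nbr i \<longleftrightarrow> i \<in> nbr j"
    and no_loops: "\<And>i. i \<notin> nbr i"
    and sets: "\<And>i. \<Omega> i \<noteq> {} \<and> compact (\<Omega> i) \<and> convex (\<Omega> i)"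
    and costs: "\<And>i y. (\<And>j. j \<noteq> i \<Longrightarrow> y $ j \<in> \<Omega> j) \<Longrightarrow>
                  convex_on UNIV (\<lambda>u. agent_cost f i u y) \<and>
                  cont_differentiable (\<lambda>u. agent_cost f i u y)"
    and strongly_monotone: "strongly_monotone_on (collective_set \<Omega>) (pseudo_gradient f)"
    and lipschitz: "\<exists>l. l-lipschitz_on (collective_set \<Omega>) (pseudo_gradient f)"
    and step_size: "\<alpha> > 0"
  shows
    "(bij (precond \<alpha> nbr :: (real^'n^'N) \<times> (real^'n^'N) \<Rightarrow> (real^'n^'N) \<times> (real^'n^'N)) \<longrightarrow>
       (\<forall>x \<sigma>.
          generated_by (precond_fb (precond \<alpha> nbr) (opA \<Omega> f nbr) (opB \<Omega> nbr)) (\<lambda>k. (x k, \<sigma> k))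
          \<longleftrightarrow> (\<exists>v. generated_by (kns_step \<alpha> \<Omega> f nbr) (\<lambda>k. (x k, v k)) \<and>
                   (\<forall>k. \<sigma> k = kron_id (weight_matrix nbr) (v k)))))
     \<and>
     (\<forall>x \<sigma> v0. \<sigma> 0 = kron_id (weight_matrix nbr) v0 \<longrightarrow>
          (generated_by (precond_fb_inclusion (precond \<alpha> nbr) (opA \<Omega> f nbr) (opB \<Omega> nbr))
             (\<lambda>k. (x k, \<sigma> k))
          \<longleftrightarrow> (\<exists>v. v 0 = v0 \<and> generated_by (kns_step \<alpha> \<Omega> f nbr) (\<lambda>k. (x k, v k)) \<and>
                   (\<forall>k. \<sigma> k = kron_id (weight_matrix nbr) (v k)))))"
proof (intro conjI impI allI)
  fix x \<sigma> :: "nat \<Rightarrow> real^'n^'N" and v0 :: "real^'n^'N"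
  assume "\<sigma> 0 = kron_id (weight_matrix nbr) v0"
  then show "generated_by (precond_fb_inclusion (precond \<alpha> nbr) (opA \<Omega> f nbr) (opB \<Omega> nbr))
      (\<lambda>k. (x k, \<sigma> k))
    \<longleftrightarrow> (\<exists>v. v 0 = v0 \<and> generated_by (kns_step \<alpha> \<Omega> f nbr) (\<lambda>k. (x k, v k)) \<and>
             (\<forall>k. \<sigma> k = kron_id (weight_matrix nbr) (v k)))"
    by (rule precond_fb_inclusion_generated_iff[OF sets step_size])
next
  fix x \<sigma> :: "nat \<Rightarrow> real^'n^'N"
  assume bij: "bij (precond \<alpha> nbr :: (real^'n^'N) \<times> (real^'n^'N) \<Rightarrow> _)"
  then have fb: "precond_fb (precond \<alpha> nbr) (opA \<Omega> f nbr) (opB \<Omega> nbr) =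
      precond_fb_inclusion (precond \<alpha> nbr) (opA \<Omega> f nbr) (opB \<Omega> nbr)"
    by (intro precond_fb_eq_precond_fb_inclusion linear_precond)
  note iff = precond_fb_inclusion_generated_iff[where \<Omega> = \<Omega> and s = \<sigma> and x = x and f = f,
      OF sets step_size]
  \<comment> \<open>Bijectivity of \<open>\<Phi>\<close> makes \<open>P\<close> surjective, so every
    \<open>\<sigma> 0\<close> lies in the range of \<open>W\<close>.\<close>
  obtain v0 where "Pmat nbr v0 = Pmat nbr (\<sigma> 0) + kron_id (laplacian_matrix nbr) (\<sigma> 0)"
    using surj_Pmat[OF bij_is_surj[OF bij]] by (metis surjD)
  then have "\<sigma> 0 = kron_id (weight_matrix nbr) v0"
    by (simp add: kron_id_weight_matrix_iff)
  \<comment> \<open>The \<open>v0\<close> just obtained serves the forward direction; the backward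
    one takes \<open>v 0\<close> of the given sequence as initial value.\<close>
  from iff[OF this] iff[of nbr] show "generated_by (precond_fb (precond \<alpha> nbr) (opA \<Omega> f nbr) (opB \<Omega> nbr))
      (\<lambda>k. (x k, \<sigma> k))
    \<longleftrightarrow> (\<exists>v. generated_by (kns_step \<alpha> \<Omega> f nbr) (\<lambda>k. (x k, v k)) \<and>
             (\<forall>k. \<sigma> k = kron_id (weight_matrix nbr) (v k)))"
    unfolding fb by blast
qed

end
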